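(* Let $B\in\mathbb{C}^{n_1\times\cdots\times n_m}$ be an $m$-mode tensor, let $k_\ell=\sum_{s=1}^t k_{\ell s}\le n_\ell$ be partitions with integers $k_{\ell s}\ge 1$, let $f$ be the associated block-diagonal objective function and $\mathscr{H}_\ell$ its partial Euclidean gradient with respect to $P_\ell$ (as defined in the context). Let $(P_{*1},\ldots,P_{*m})$, with $P_{*\ell}\in\mathrm{St}(k_\ell,n_\ell)$ for all $1\le\ell\le m$, be a global maximizer tuple of $$\max_{P_\ell\in\mathrm{St}(k_\ell,n_\ell),\ 1\le\ell\le m} f(P_1,\ldots,P_m).$$ Then for every $1\le\ell\le m$, $$\mathscr{H}_\ell(P_{*1},\ldots,P_{*m})=P_{*\ell}\Lambda_{*\ell},\qquad \Lambda_{*\ell}=P_{*\ell}^H\mathscr{H}_\ell(P_{*1},\ldots,P_{*m})\succeq0 .$$ In particular, the KKT condition $\mathscr{H}_\ell(P_1,\ldots,P_m)=P_\ell\Lambda_\ell$ with $P_\ell\in\mathrm{St}(k_\ell,n_\ell)$ and $\Lambda_\ell=\Lambda_\ell^H\in\mathbb{C}^{k_\ell\times k_\ell}$ for all $\ell$ holds with $P_\ell=P_{*\ell}$ for all $\ell$.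
   Context: $X^H$ is the conjugate transpose; $A\succeq0$ means Hermitian positive semidefinite; $\mathrm{St}(k,n)=\{P\in\mathbb{C}^{n\times k}:P^HP=I_k\}$. Let $m\ge 2$, $t\ge1$. For an $m$-mode tensor $B=[b_{i_1\cdots i_m}]\in\mathbb{C}^{n_1\times\cdots\times n_m}$: $\|B\|_F=(\sum|b_{i_1\cdots i_m}|^2)^{1/2}$. For $X=[x_{ij}]\in\mathbb{C}^{k\times n_\ell}$, the $\ell$th mode-multiplication $B\times_\ell X\in\mathbb{C}^{n_1\times\cdots\times n_{\ell-1}\times k\times n_{\ell+1}\times\cdots\times n_m}$ has entries $(B\times_\ell X)_{(i_1\cdots i_m)}=\sum_{j=1}^{n_\ell}x_{i_\ell j}\,b_{i_1\cdots i_{\ell-1}\,j\,i_{\ell+1}\cdots i_m}$. The $\ell$th unfolding $B_{\mathrm{ufd},\ell}\in\mathbb{C}^{n_\ell\times (n_1\cdots n_m/n_\ell)}$ is the matrix whose columns are the vectors obtained by letting the $\ell$th index run from $1$ to $n_\ell$ with all other indices fixed (columns arranged in any fixed order). Partitions $k_\ell=\sum_{s=1}^tk_{\ell s}\le n_\ell$ (integers $k_{\ell s}\ge1$), $1\le\ell\le m$, are given. Each $P_\ell\in\mathbb{C}^{n_\ell\times k_\ell}$ is partitioned columnwise as $P_\ell=[P_{\ell1},\ldots,P_{\ell t}]$ with $P_{\ell s}\in\mathbb{C}^{n_\ell\times k_{\ell s}}$. The objective is $$f(P_1,\ldots,P_m)=\sum_{s=1}^t\big\|B\times_1P_{1s}^H\times_2P_{2s}^H\cdots\times_mP_{ms}^H\big\|_F^2,$$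 i.e. the squared Frobenius norm of the block-diagonal part (diagonal blocks of sizes $k_{1s}\times\cdots\times k_{ms}$, $1\le s\le t$) of $B\times_1P_1^H\cdots\times_mP_m^H$. For $1\le\ell\le m$, $1\le s\le t$, let $C_{\ell s}$ be the $\ell$th unfolding of the tensor obtained from $B$ by mode-multiplications $\times_iP_{is}^H$ for all $i\ne\ell$, and $H_{\ell s}=C_{\ell s}C_{\ell s}^H\in\mathbb{C}^{n_\ell\times n_\ell}$ (depending on $P_{is}$, $i\neq \ell$). The partial Euclidean gradient of $f$ with respect to $P_\ell$ (with respect to the real inner product $\langle X,Y\rangle=\Re\,\mathrm{tr}(Y^HX)$) is $$\mathscr{H}_\ell(P_1,\ldots,P_m)=2\,[H_{\ell1}P_{\ell1},\ldots,H_{\ell t}P_{\ell t}]\in\mathbb{C}^{n_\ell\times k_\ell}.$$ *)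

theory Defs
  imports "HOL-Analysis.Analysis" "Jordan_Normal_Form.Schur_Decomposition"
begin

text \<open>
  All indices (modes, blocks, tensor and matrix entries) are 0-based;
  \<^const>\<open>mat_adjoint\<close> is the conjugate transpose.
\<close>

section \<open>Tensors\<close>

text \<open>
  A tensor carries its list of dimensions and its entries, a function of the list of indices.
  Values of \<open>tentry\<close> outside \<open>tindices\<close> are irrelevant.
\<close>

datatype tensor = Tensor (tdims: "nat list") (tentry: "nat list \<Rightarrow> complex")

definition tindices :: "nat list \<Rightarrow> nat list set" where
  "tindices d = {is. length is = length d \<and> (\<forall>i < length d. is ! i < d ! i)}"

definition tnorm :: "tensor \<Rightarrow> real" where
  "tnorm T = sqrt (\<Sum>is \<in> tindices (tdims T). (cmod (tentry T is))\<^sup>2)"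

definition mode_mult :: "tensor \<Rightarrow> nat \<Rightarrow> complex mat \<Rightarrow> tensor" where
  "mode_mult T l X = Tensor ((tdims T)[l := dim_row X])
     (\<lambda>is. \<Sum>j < tdims T ! l. X $$ (is ! l, j) * tentry T (is[l := j]))"

definition mode_mults :: "tensor \<Rightarrow> nat list \<Rightarrow> (nat \<Rightarrow> complex mat) \<Rightarrow> tensor" where
  "mode_mults T I X = fold (\<lambda>i T'. mode_mult T' i (X i)) I T"

text \<open>
  The columns of the unfolding are enumerated, in lexicographic order, by the index lists whose
  \<open>l\<close>-th entry is 0; this entry is then replaced by the row index.
\<close>

definition ufd_cols :: "nat list \<Rightarrow> nat \<Rightarrow> nat list list" where
  "ufd_cols d l = product_lists (map (\<lambda>k. [0..<k]) (d[l := 1]))"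

definition unfolding_mat :: "tensor \<Rightarrow> nat \<Rightarrow> complex mat" where
  "unfolding_mat T l = (let js = ufd_cols (tdims T) l in
     mat (tdims T ! l) (length js) (\<lambda>(i, c). tentry T ((js ! c)[l := i])))"

section \<open>Matrices\<close>

definition stiefel :: "nat \<Rightarrow> nat \<Rightarrow> complex mat set" where
  "stiefel k n = {P \<in> carrier_mat n k. mat_adjoint P * P = 1\<^sub>m k}"

definition hermitian_psd :: "complex mat \<Rightarrow> bool" where
  "hermitian_psd A \<longleftrightarrow> square_mat A \<and> mat_adjoint A = A \<and>
     (\<forall>v \<in> carrier_vec (dim_row A). 0 \<le> Re ((A *\<^sub>v v) \<bullet>c v))"

text \<open>The \<open>s\<close>-th column block of \<open>A\<close> when the columns are split into blocks of widths \<open>\<kappa> 0, \<kappa> 1, \<dots>\<close>\<close>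

definition col_block :: "(nat \<Rightarrow> nat) \<Rightarrow> nat \<Rightarrow> complex mat \<Rightarrow> complex mat" where
  "col_block \<kappa> s A = mat (dim_row A) (\<kappa> s) (\<lambda>(i, j). A $$ (i, (\<Sum>r<s. \<kappa> r) + j))"

definition hcat :: "nat \<Rightarrow> complex mat list \<Rightarrow> complex mat" where
  "hcat n As = mat_of_cols n (concat (map cols As))"

definition mat_rinner :: "complex mat \<Rightarrow> complex mat \<Rightarrow> real" where
  "mat_rinner X Y = Re (\<Sum>i < dim_col Y. (mat_adjoint Y * X) $$ (i, i))"

definition mat_fnorm :: "complex mat \<Rightarrow> real" where
  "mat_fnorm X = sqrt (mat_rinner X X)"

section \<open>The block-diagonal objective and its partial gradients\<close>

text \<open>
  \<open>\<kappa> l s\<close> is the width of the \<open>s\<close>-th column block of the \<open>l\<close>-th matrix \<open>P l\<close>,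
  for modes \<open>l\<close> below the order of \<open>B\<close> and \<open>s < t\<close>.
\<close>

definition bd_objective ::
    "tensor \<Rightarrow> nat \<Rightarrow> (nat \<Rightarrow> nat \<Rightarrow> nat) \<Rightarrow> (nat \<Rightarrow> complex mat) \<Rightarrow> real" where
  "bd_objective B t \<kappa> P = (\<Sum>s<t.
     (tnorm (mode_mults B [0..<length (tdims B)]
               (\<lambda>i. mat_adjoint (col_block (\<kappa> i) s (P i)))))\<^sup>2)"

definition partial_unfolding ::
    "tensor \<Rightarrow> (nat \<Rightarrow> nat \<Rightarrow> nat) \<Rightarrow> (nat \<Rightarrow> complex mat) \<Rightarrow> nat \<Rightarrow> nat \<Rightarrow> complex mat" where
  "partial_unfolding B \<kappa> P l s =
     unfolding_mat (mode_mults B (filter (\<lambda>i. i \<noteq> l) [0..<length (tdims B)])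
                      (\<lambda>i. mat_adjoint (col_block (\<kappa> i) s (P i)))) l"

definition partial_gram ::
    "tensor \<Rightarrow> (nat \<Rightarrow> nat \<Rightarrow> nat) \<Rightarrow> (nat \<Rightarrow> complex mat) \<Rightarrow> nat \<Rightarrow> nat \<Rightarrow> complex mat" where
  "partial_gram B \<kappa> P l s = partial_unfolding B \<kappa> P l s * mat_adjoint (partial_unfolding B \<kappa> P l s)"

definition bd_gradient ::
    "tensor \<Rightarrow> nat \<Rightarrow> (nat \<Rightarrow> nat \<Rightarrow> nat) \<Rightarrow> nat \<Rightarrow> (nat \<Rightarrow> complex mat) \<Rightarrow> complex mat" where
  "bd_gradient B t \<kappa> l P = 2 \<cdot>\<^sub>m hcat (tdims B ! l)
     (map (\<lambda>s. partial_gram B \<kappa> P l s * col_block (\<kappa> l) s (P l)) [0..<t])"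

definition stiefel_tuple ::
    "tensor \<Rightarrow> nat \<Rightarrow> (nat \<Rightarrow> nat \<Rightarrow> nat) \<Rightarrow> (nat \<Rightarrow> complex mat) \<Rightarrow> bool" where
  "stiefel_tuple B t \<kappa> P \<longleftrightarrow>
     (\<forall>l < length (tdims B). P l \<in> stiefel (\<Sum>s<t. \<kappa> l s) (tdims B ! l))"

definition bd_global_maximizer ::
    "tensor \<Rightarrow> nat \<Rightarrow> (nat \<Rightarrow> nat \<Rightarrow> nat) \<Rightarrow> (nat \<Rightarrow> complex mat) \<Rightarrow> bool" where
  "bd_global_maximizer B t \<kappa> P \<longleftrightarrow> stiefel_tuple B t \<kappa> P \<and>
     (\<forall>Q. stiefel_tuple B t \<kappa> Q \<longrightarrow> bd_objective B t \<kappa> Q \<le> bd_objective B t \<kappa> P)"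

definition bd_KKT ::
    "tensor \<Rightarrow> nat \<Rightarrow> (nat \<Rightarrow> nat \<Rightarrow> nat) \<Rightarrow> (nat \<Rightarrow> complex mat) \<Rightarrow> bool" where
  "bd_KKT B t \<kappa> P \<longleftrightarrow> stiefel_tuple B t \<kappa> P \<and>
     (\<forall>l < length (tdims B). \<exists>\<Lambda> \<in> carrier_mat (\<Sum>s<t. \<kappa> l s) (\<Sum>s<t. \<kappa> l s).
        mat_adjoint \<Lambda> = \<Lambda> \<and> bd_gradient B t \<kappa> l P = P l * \<Lambda>)"

section \<open>\<open>bd_gradient\<close> is the partial Euclidean gradient of \<open>bd_objective\<close>\<close>

definition is_euclidean_gradient ::
    "nat \<Rightarrow> nat \<Rightarrow> (complex mat \<Rightarrow> real) \<Rightarrow> complex mat \<Rightarrow> complex mat \<Rightarrow> bool" where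
  "is_euclidean_gradient n k \<phi> X G \<longleftrightarrow> G \<in> carrier_mat n k \<and>
     (\<forall>e>0. \<exists>d>0. \<forall>Z \<in> carrier_mat n k. mat_fnorm Z < d \<longrightarrow>
        \<bar>\<phi> (X + Z) - \<phi> X - mat_rinner G Z\<bar> \<le> e * mat_fnorm Z)"

lemma dim_mat_adjoint [simp]:
  "dim_row (mat_adjoint A) = dim_col A" "dim_col (mat_adjoint A) = dim_row A"
  by (auto simp: mat_adjoint_def)

lemma index_mat_adjoint [simp]:
  fixes A :: "complex mat"
  shows "i < dim_col A \<Longrightarrow> j < dim_row A \<Longrightarrow> mat_adjoint A $$ (i, j) = cnj (A $$ (j, i))"
  by (simp add: mat_adjoint_def mat_of_rows_index conjugate_complex_def)

lemma tdims_mode_mult [simp]: "tdims (mode_mult T l X) = (tdims T)[l := dim_row X]"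
  by (simp add: mode_mult_def)

lemma mode_mult_commute:
  assumes "i \<noteq> j"
  shows "mode_mult (mode_mult T i X) j Y = mode_mult (mode_mult T j Y) i X"
proof -
  have "(\<Sum>b < tdims T ! j. Y $$ (is ! j, b) * (\<Sum>a < tdims T ! i. X $$ (is ! i, a) * tentry T (is[j := b, i := a])))
      = (\<Sum>a < tdims T ! i. X $$ (is ! i, a) * (\<Sum>b < tdims T ! j. Y $$ (is ! j, b) * tentry T (is[i := a, j := b])))"
    for "is"
    unfolding sum_distrib_left
    by (subst sum.swap) (use assms in \<open>simp add: list_update_swap mult.left_commute\<close>)
  then show ?thesis
    using assms by (simp add: mode_mult_def list_update_swap)
qed

lemma mode_mults_commute:
  "l \<notin> set I \<Longrightarrow> mode_mults (mode_mult T l X) I Y = mode_mult (mode_mults T I Y) l X"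
  unfolding mode_mults_def
  by (induction I arbitrary: T) (auto simp: mode_mult_commute[of l])

lemma mode_mults_split:
  assumes "l < m"
  shows "mode_mults T [0..<m] Y = mode_mult (mode_mults T (filter (\<lambda>i. i \<noteq> l) [0..<m]) Y) l (Y l)"
proof -
  have m: "[0..<m] = [0..<l] @ l # [Suc l..<m]"
    using assms by (metis less_imp_le_nat upt_add_eq_append le_add_diff_inverse upt_conv_Cons zero_le)
  have f: "filter (\<lambda>i. i \<noteq> l) [0..<m] = [0..<l] @ [Suc l..<m]"
    unfolding m by (simp add: filter_id_conv)
  have "mode_mults T [0..<m] Y = mode_mults (mode_mult (mode_mults T [0..<l] Y) l (Y l)) [Suc l..<m] Y"
    unfolding m by (simp add: mode_mults_def)
  also have "\<dots> = mode_mult (mode_mults (mode_mults T [0..<l] Y) [Suc l..<m] Y) l (Y l)"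
    by (rule mode_mults_commute) auto
  finally show ?thesis unfolding f by (simp add: mode_mults_def)
qed

lemma mode_mults_cong:
  "(\<And>i. i \<in> set I \<Longrightarrow> X i = Y i) \<Longrightarrow> mode_mults T I X = mode_mults T I Y"
  unfolding mode_mults_def by (rule List.fold_cong[OF refl refl]) auto

lemma length_tdims_mode_mults [simp]: "length (tdims (mode_mults T I X)) = length (tdims T)"
  unfolding mode_mults_def by (induction I arbitrary: T) auto

lemma nth_tdims_mode_mults: "l \<notin> set I \<Longrightarrow> tdims (mode_mults T I X) ! l = tdims T ! l"
  unfolding mode_mults_def by (induction I arbitrary: T) auto

lemma ufd_cols_props:
  "set (ufd_cols d l) = tindices (d[l := 1])" "distinct (ufd_cols d l)"
  by (auto simp: ufd_cols_def product_lists_set list_all2_conv_all_nth tindices_def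
        intro!: distinct_product_lists)

lemma finite_tindices [simp]: "finite (tindices d)"
proof -
  have "tindices d = set (product_lists (map (\<lambda>k. [0..<k]) d))"
    by (auto simp: product_lists_set list_all2_conv_all_nth tindices_def)
  then show ?thesis by simp
qed

lemma sum_tindices_split:
  assumes l: "l < length d"
  shows "(\<Sum>is \<in> tindices (d[l := k]). g is)
       = (\<Sum>a<k. \<Sum>c < length (ufd_cols d l). g ((ufd_cols d l ! c)[l := a]))"
proof -
  have "(\<Sum>is \<in> tindices (d[l := k]). g is)
      = (\<Sum>(a, js) \<in> {..<k} \<times> tindices (d[l := 1]). g (js[l := a]))"
  proof (rule sum.reindex_bij_witness[where i = "\<lambda>(a, js). js[l := a]" and j = "\<lambda>is. (is ! l, is[l := 0])"],
      goal_cases)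
    case (2 "is") then show ?case using l by (auto simp: tindices_def nth_list_update split: if_splits)
  next
    case (3 b)
    then have "(snd b) ! l = 0" "length (snd b) = length d"
      using l by (auto simp: tindices_def nth_list_update dest: spec[where x = l])
    then have "(snd b)[l := 0] = snd b" by (metis list_update_id)
    then show ?case using l \<open>length (snd b) = length d\<close> by (cases b) auto
  next
    case (4 b) then show ?case using l by (auto simp: tindices_def nth_list_update split: if_splits)
  qed auto
  also have "\<dots> = (\<Sum>a<k. \<Sum>js \<in> tindices (d[l := 1]). g (js[l := a]))"
    by (simp add: sum.cartesian_product)
  also have "\<dots> = (\<Sum>a<k. \<Sum>c < length (ufd_cols d l). g ((ufd_cols d l ! c)[l := a]))"
    by (intro sum.cong refl sum.reindex_bij_betw[symmetric, where h = "\<lambda>c. ufd_cols d l ! c"]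
          bij_betw_nth) (auto simp: ufd_cols_props)
  finally show ?thesis .
qed

definition mode_quad :: "nat \<Rightarrow> complex mat \<Rightarrow> complex mat \<Rightarrow> real" where
  "mode_quad k C W = (\<Sum>a<k. \<Sum>c<dim_col C. (cmod (\<Sum>j<dim_row C. cnj (W $$ (j, a)) * C $$ (j, c)))\<^sup>2)"

lemma tnorm_mode_mult_adjoint:
  assumes l: "l < length (tdims T)" and W: "W \<in> carrier_mat (tdims T ! l) k"
  shows "(tnorm (mode_mult T l (mat_adjoint W)))\<^sup>2 = mode_quad k (unfolding_mat T l) W"
proof -
  have len: "c < length (ufd_cols (tdims T) l) \<Longrightarrow> l < length (ufd_cols (tdims T) l ! c)" for c
    using nth_mem[of c "ufd_cols (tdims T) l"] l by (auto simp: ufd_cols_props tindices_def)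
  have "(tnorm (mode_mult T l (mat_adjoint W)))\<^sup>2
      = (\<Sum>is \<in> tindices ((tdims T)[l := k]). (cmod (tentry (mode_mult T l (mat_adjoint W)) is))\<^sup>2)"
    using W by (simp add: tnorm_def sum_nonneg)
  also have "\<dots> = mode_quad k (unfolding_mat T l) W"
    unfolding sum_tindices_split[OF l] mode_quad_def
    using W len by (auto intro!: sum.cong arg_cong[where f = "\<lambda>x. (cmod x)\<^sup>2"]
        simp: mode_mult_def unfolding_mat_def Let_def)
  finally show ?thesis .
qed

lemma bd_objective_update:
  assumes l: "l < length (tdims B)" and W: "dim_row W = tdims B ! l"
  shows "bd_objective B t \<kappa> (P(l := W))
       = (\<Sum>s<t. mode_quad (\<kappa> l s) (partial_unfolding B \<kappa> P l s) (col_block (\<kappa> l) s W))"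
  unfolding bd_objective_def
proof (intro sum.cong refl, goal_cases)
  case (1 s)
  let ?I = "filter (\<lambda>i. i \<noteq> l) [0..<length (tdims B)]"
  let ?X = "\<lambda>i. mat_adjoint (col_block (\<kappa> i) s ((P(l := W)) i))"
  let ?Y = "\<lambda>i. mat_adjoint (col_block (\<kappa> i) s (P i))"
  have "mode_mults B [0..<length (tdims B)] ?X = mode_mult (mode_mults B ?I ?X) l (?X l)"
    using l by (rule mode_mults_split)
  also have "mode_mults B ?I ?X = mode_mults B ?I ?Y"
    by (rule mode_mults_cong) auto
  finally show ?case
    unfolding partial_unfolding_def
    using l W by (simp add: tnorm_mode_mult_adjoint nth_tdims_mode_mults col_block_def)
qed

lemma mat_rinner_sum:
  assumes "X \<in> carrier_mat n k" "Y \<in> carrier_mat n k"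
  shows "mat_rinner X Y = (\<Sum>a<k. \<Sum>i<n. Re (cnj (Y $$ (i, a)) * X $$ (i, a)))"
  using assms unfolding mat_rinner_def
  by (simp add: scalar_prod_def atLeast0LessThan)

lemma mat_fnorm_sq:
  assumes "Z \<in> carrier_mat n k"
  shows "(mat_fnorm Z)\<^sup>2 = (\<Sum>a<k. \<Sum>i<n. (cmod (Z $$ (i, a)))\<^sup>2)"
proof -
  have "mat_rinner Z Z = (\<Sum>a<k. \<Sum>i<n. (cmod (Z $$ (i, a)))\<^sup>2)"
    unfolding mat_rinner_sum[OF assms assms]
    by (intro sum.cong refl) (unfold cmod_power2, simp add: power2_eq_square)
  then show ?thesis by (simp add: mat_fnorm_def sum_nonneg)
qed

lemma mat_fnorm_nonneg: "Z \<in> carrier_mat n k \<Longrightarrow> 0 \<le> mat_fnorm Z"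
  by (simp add: mat_fnorm_def mat_rinner_sum sum_nonneg)

lemma cmod_le_mat_fnorm:
  assumes "Z \<in> carrier_mat n k" "i < n" "a < k"
  shows "cmod (Z $$ (i, a)) \<le> mat_fnorm Z"
proof (rule power2_le_imp_le)
  have "(cmod (Z $$ (i, a)))\<^sup>2 \<le> (\<Sum>i<n. (cmod (Z $$ (i, a)))\<^sup>2)"
    using assms by (intro member_le_sum) auto
  also have "\<dots> \<le> (\<Sum>a<k. \<Sum>i<n. (cmod (Z $$ (i, a)))\<^sup>2)"
    using assms by (intro member_le_sum[where f = "\<lambda>a. \<Sum>i<n. (cmod (Z $$ (i, a)))\<^sup>2"]) (auto simp: sum_nonneg)
  finally show "(cmod (Z $$ (i, a)))\<^sup>2 \<le> (mat_fnorm Z)\<^sup>2"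
    using mat_fnorm_sq[OF assms(1)] by simp
qed (use assms mat_fnorm_nonneg in auto)

lemma mode_quad_add:
  assumes "X \<in> carrier_mat n k" "Z \<in> carrier_mat n k" "dim_row C = n"
  shows "mode_quad k C (X + Z) = mode_quad k C X + mode_quad k C Z
       + 2 * mat_rinner (C * mat_adjoint C * X) Z"
proof -
  define x where "x W a c = (\<Sum>j<n. cnj (W $$ (j, a)) * C $$ (j, c))" for W :: "complex mat" and a c
  have add: "x (X + Z) a c = x X a c + x Z a c" if "a < k" for a c
    using that assms by (simp add: x_def sum.distrib distrib_right)
  have sq: "(cmod (u + v))\<^sup>2 = (cmod u)\<^sup>2 + (cmod v)\<^sup>2 + 2 * Re (cnj u * v)" for u v
    unfolding cmod_power2 by (simp add: power2_eq_square algebra_simps)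
  have gram: "(C * mat_adjoint C * X) $$ (i, a)
      = (\<Sum>j<n. (\<Sum>c<dim_col C. C $$ (i, c) * cnj (C $$ (j, c))) * X $$ (j, a))"
    if "i < n" "a < k" for i a
    using that assms by (simp add: scalar_prod_def atLeast0LessThan)
  have gram_sum: "(\<Sum>c<dim_col C. cnj (x X a c) * x Z a c)
      = (\<Sum>i<n. cnj (Z $$ (i, a)) * (C * mat_adjoint C * X) $$ (i, a))" if "a < k" for a
  proof -
    have "(\<Sum>c<dim_col C. cnj (x X a c) * x Z a c)
        = (\<Sum>c<dim_col C. \<Sum>i<n. \<Sum>j<n. cnj (Z $$ (i, a)) * (C $$ (i, c) * cnj (C $$ (j, c)) * X $$ (j, a)))"
      unfolding x_def cnj_sum sum_product
      by (subst sum.swap) (intro sum.cong refl; simp add: mult_ac)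
    also have "\<dots> = (\<Sum>i<n. \<Sum>c<dim_col C. \<Sum>j<n. cnj (Z $$ (i, a)) * (C $$ (i, c) * cnj (C $$ (j, c)) * X $$ (j, a)))"
      by (rule sum.swap)
    also have "\<dots> = (\<Sum>i<n. \<Sum>j<n. \<Sum>c<dim_col C. cnj (Z $$ (i, a)) * (C $$ (i, c) * cnj (C $$ (j, c)) * X $$ (j, a)))"
      by (rule sum.cong[OF refl], rule sum.swap)
    also have "\<dots> = (\<Sum>i<n. cnj (Z $$ (i, a)) * (C * mat_adjoint C * X) $$ (i, a))"
      using that by (intro sum.cong refl) (simp add: gram sum_distrib_left sum_distrib_right)
    finally show ?thesis .
  qed
  have *: "(\<Sum>c<dim_col C. Re (cnj (x X a c) * x Z a c))
      = (\<Sum>i<n. Re (cnj (Z $$ (i, a)) * (C * mat_adjoint C * X) $$ (i, a)))" if "a < k" for a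
    using arg_cong[OF gram_sum[OF that], of Re] by (simp only: Re_sum)
  have G: "C * mat_adjoint C * X \<in> carrier_mat n k"
    using assms by auto
  have "mode_quad k C (X + Z) = (\<Sum>a<k. \<Sum>c<dim_col C. (cmod (x X a c))\<^sup>2 + (cmod (x Z a c))\<^sup>2
         + 2 * Re (cnj (x X a c) * x Z a c))"
    unfolding mode_quad_def x_def[symmetric] assms(3)
    by (intro sum.cong refl) (simp add: add sq)
  also have "\<dots> = mode_quad k C X + mode_quad k C Z
      + 2 * (\<Sum>a<k. \<Sum>c<dim_col C. Re (cnj (x X a c) * x Z a c))"
    unfolding mode_quad_def assms(3) x_def[symmetric]
    by (simp only: sum.distrib sum_distrib_left)
  also have "(\<Sum>a<k. \<Sum>c<dim_col C. Re (cnj (x X a c) * x Z a c)) = mat_rinner (C * mat_adjoint C * X) Z"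
    unfolding mat_rinner_sum[OF G assms(2)] by (rule sum.cong[OF refl]) (rule *, simp)
  finally show ?thesis .
qed

lemma mode_quad_bounds:
  assumes b: "\<And>i a. i < dim_row C \<Longrightarrow> a < k \<Longrightarrow> cmod (Z $$ (i, a)) \<le> r"
  shows "0 \<le> mode_quad k C Z"
    "mode_quad k C Z \<le> (\<Sum>a<k. \<Sum>c<dim_col C. (\<Sum>j<dim_row C. cmod (C $$ (j, c)))\<^sup>2) * r\<^sup>2"
proof -
  show "0 \<le> mode_quad k C Z" by (simp add: mode_quad_def sum_nonneg)
  show "mode_quad k C Z \<le> (\<Sum>a<k. \<Sum>c<dim_col C. (\<Sum>j<dim_row C. cmod (C $$ (j, c)))\<^sup>2) * r\<^sup>2"
    unfolding mode_quad_def sum_distrib_right power_mult_distrib[symmetric]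
  proof (intro sum_mono power_mono norm_ge_zero)
    fix a c assume "a \<in> {..<k}"
    then show "cmod (\<Sum>j<dim_row C. cnj (Z $$ (j, a)) * C $$ (j, c)) \<le> (\<Sum>j<dim_row C. cmod (C $$ (j, c)) * r)"
      by (intro sum_norm_le) (simp add: norm_mult, subst mult.commute, intro mult_left_mono b, auto)
  qed
qed

lemma sum_blocks:
  fixes \<kappa> :: "nat \<Rightarrow> nat"
  shows "(\<Sum>a < (\<Sum>s<t. \<kappa> s). g a) = (\<Sum>s<t. \<Sum>a<\<kappa> s. g ((\<Sum>r<s. \<kappa> r) + a))"
proof (induction t)
  case (Suc t)
  have "(\<Sum>a < u + v. g a) = (\<Sum>a<u. g a) + (\<Sum>a<v. g (u + a))" for u v :: nat
    by (induction v) (simp_all add: add.assoc)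
  then show ?case using Suc by simp
qed simp

lemma offset_less:
  fixes \<kappa> :: "nat \<Rightarrow> nat"
  assumes "s < t" "a < \<kappa> s"
  shows "(\<Sum>r<s. \<kappa> r) + a < (\<Sum>r<t. \<kappa> r)"
proof -
  have "(\<Sum>r<s. \<kappa> r) + a < (\<Sum>r<Suc s. \<kappa> r)" using assms by simp
  also have "\<dots> \<le> (\<Sum>r<t. \<kappa> r)" using assms by (intro sum_mono2) auto
  finally show ?thesis .
qed

lemma nth_concat_blocks:
  assumes "\<And>s. s < t \<Longrightarrow> length (f s) = \<kappa> s"
  shows "length (concat (map f [0..<t])) = (\<Sum>s<t. \<kappa> s)"
    and "s < t \<Longrightarrow> a < \<kappa> s \<Longrightarrow> concat (map f [0..<t]) ! ((\<Sum>r<s. \<kappa> r) + a) = f s ! a"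
  using assms
proof (induction t)
  case (Suc t)
  {
    case 1 then show ?case using Suc by simp
  next
    case 2
    have len: "length (concat (map f [0..<t])) = (\<Sum>s<t. \<kappa> s)" using 2 Suc by simp
    show ?case
    proof (cases "s = t")
      case True then show ?thesis using len by (simp add: nth_append)
    next
      case False
      then have "s < t" using 2 by simp
      then show ?thesis using len offset_less[of s t a \<kappa>] 2 Suc by (simp add: nth_append)
    qed
  }
qed simp_all

lemma bd_gradient_carrier_entry:
  assumes l: "l < length (tdims B)" and P: "P l \<in> carrier_mat (tdims B ! l) (\<Sum>s<t. \<kappa> l s)"
  shows "bd_gradient B t \<kappa> l P \<in> carrier_mat (tdims B ! l) (\<Sum>s<t. \<kappa> l s)"
    and "i < tdims B ! l \<Longrightarrow> s < t \<Longrightarrow> a < \<kappa> l s \<Longrightarrow>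
      bd_gradient B t \<kappa> l P $$ (i, (\<Sum>r<s. \<kappa> l r) + a)
        = 2 * (partial_gram B \<kappa> P l s * col_block (\<kappa> l) s (P l)) $$ (i, a)"
proof -
  let ?f = "\<lambda>s. cols (partial_gram B \<kappa> P l s * col_block (\<kappa> l) s (P l))"
  have r: "dim_row (partial_gram B \<kappa> P l s) = tdims B ! l" for s
    by (simp add: partial_gram_def partial_unfolding_def unfolding_mat_def Let_def nth_tdims_mode_mults)
  have len: "length (?f s) = \<kappa> l s" for s by (simp add: col_block_def)
  have eq: "bd_gradient B t \<kappa> l P = 2 \<cdot>\<^sub>m mat_of_cols (tdims B ! l) (concat (map ?f [0..<t]))"
    by (simp add: bd_gradient_def hcat_def comp_def)
  note n = nth_concat_blocks[where f = ?f and \<kappa> = "\<kappa> l", OF len]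
  show "bd_gradient B t \<kappa> l P \<in> carrier_mat (tdims B ! l) (\<Sum>s<t. \<kappa> l s)"
    unfolding eq using n(1)[of t] by (intro carrier_matI) simp_all
  assume a: "i < tdims B ! l" "s < t" "a < \<kappa> l s"
  have d: "a < dim_col (partial_gram B \<kappa> P l s * col_block (\<kappa> l) s (P l))"
    using a by (simp add: col_block_def)
  have "(\<Sum>r<s. \<kappa> l r) + a < length (concat (map ?f [0..<t]))"
    using offset_less[of s t a "\<kappa> l"] a n(1)[of t] by simp
  then have "bd_gradient B t \<kappa> l P $$ (i, (\<Sum>r<s. \<kappa> l r) + a) = 2 * (?f s ! a) $ i"
    unfolding eq using a n(2)[OF a(2,3)] by (simp add: mat_of_cols_index)
  also have "(?f s ! a) $ i = (partial_gram B \<kappa> P l s * col_block (\<kappa> l) s (P l)) $$ (i, a)"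
    using a d r by (simp only: cols_nth) (simp add: col_def)
  finally show "bd_gradient B t \<kappa> l P $$ (i, (\<Sum>r<s. \<kappa> l r) + a)
        = 2 * (partial_gram B \<kappa> P l s * col_block (\<kappa> l) s (P l)) $$ (i, a)" .
qed

theorem bd_gradient_is_euclidean_gradient:
  assumes l: "l < length (tdims B)" and P: "P l \<in> carrier_mat (tdims B ! l) (\<Sum>s<t. \<kappa> l s)"
  shows "is_euclidean_gradient (tdims B ! l) (\<Sum>s<t. \<kappa> l s)
           (\<lambda>X. bd_objective B t \<kappa> (P(l := X))) (P l) (bd_gradient B t \<kappa> l P)"
proof -
  define n where "n = tdims B ! l"
  define k where "k = (\<Sum>s<t. \<kappa> l s)"
  define C where "C s = partial_unfolding B \<kappa> P l s" for s
  define blk where "blk s X = col_block (\<kappa> l) s X" for s X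
  define \<phi> where "\<phi> = (\<lambda>X. bd_objective B t \<kappa> (P(l := X)))"
  define K where "K = (\<Sum>s<t. \<Sum>a<\<kappa> l s. \<Sum>c<dim_col (C s). (\<Sum>j<dim_row (C s). cmod (C s $$ (j, c)))\<^sup>2)"
  have K0: "0 \<le> K" by (simp add: K_def sum_nonneg)
  have P': "P l \<in> carrier_mat n k" using P by (simp add: n_def k_def)
  note G = bd_gradient_carrier_entry[where \<kappa> = \<kappa> and P = P and t = t, OF l P]
  have Gc: "bd_gradient B t \<kappa> l P \<in> carrier_mat n k" using G(1) by (simp add: n_def k_def)
  have dC: "dim_row (C s) = n" for s
    by (simp add: C_def partial_unfolding_def unfolding_mat_def Let_def nth_tdims_mode_mults n_def)
  have \<phi>: "\<phi> X = (\<Sum>s<t. mode_quad (\<kappa> l s) (C s) (blk s X))" if "X \<in> carrier_mat n k" for X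
    using that bd_objective_update[OF l] by (auto simp: \<phi>_def C_def blk_def n_def)
  have blkc: "blk s X \<in> carrier_mat n (\<kappa> l s)" if "X \<in> carrier_mat n k" for s X
    using that by (auto simp: blk_def col_block_def)
  have expand: "\<phi> (P l + Z) - \<phi> (P l) - mat_rinner (bd_gradient B t \<kappa> l P) Z
      = (\<Sum>s<t. mode_quad (\<kappa> l s) (C s) (blk s Z))" if Z: "Z \<in> carrier_mat n k" for Z
  proof -
    have add: "blk s (P l + Z) = blk s (P l) + blk s Z" if "s < t" for s
      using that Z P' offset_less[of s t _ "\<kappa> l"]
      by (intro eq_matI) (auto simp: blk_def col_block_def k_def)
    have "mat_rinner (bd_gradient B t \<kappa> l P) Z
        = (\<Sum>s<t. \<Sum>a<\<kappa> l s. \<Sum>i<n. Re (cnj (Z $$ (i, (\<Sum>r<s. \<kappa> l r) + a))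
             * bd_gradient B t \<kappa> l P $$ (i, (\<Sum>r<s. \<kappa> l r) + a)))"
      unfolding mat_rinner_sum[OF Gc Z] unfolding k_def by (rule sum_blocks[where g = "\<lambda>a. \<Sum>i<n. Re (cnj (Z $$ (i, a)) * bd_gradient B t \<kappa> l P $$ (i, a))"])
    also have "\<dots> = (\<Sum>s<t. 2 * mat_rinner (C s * mat_adjoint (C s) * blk s (P l)) (blk s Z))"
    proof (rule sum.cong[OF refl])
      fix s assume s: "s \<in> {..<t}"
      have "C s * mat_adjoint (C s) * blk s (P l) \<in> carrier_mat n (\<kappa> l s)"
        by (intro mult_carrier_mat[of _ _ n] mult_carrier_mat[of _ _ "dim_col (C s)"] blkc[OF P']) (auto simp: dC intro!: carrier_matI)
      note in_eq = mat_rinner_sum[OF this blkc[OF Z, of s]]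
      show "(\<Sum>a<\<kappa> l s. \<Sum>i<n. Re (cnj (Z $$ (i, (\<Sum>r<s. \<kappa> l r) + a))
             * bd_gradient B t \<kappa> l P $$ (i, (\<Sum>r<s. \<kappa> l r) + a)))
          = 2 * mat_rinner (C s * mat_adjoint (C s) * blk s (P l)) (blk s Z)"
        unfolding in_eq sum_distrib_left
      proof (rule sum.cong[OF refl], rule sum.cong[OF refl])
        fix a i assume ai: "a \<in> {..<\<kappa> l s}" "i \<in> {..<n}"
        have "bd_gradient B t \<kappa> l P $$ (i, (\<Sum>r<s. \<kappa> l r) + a)
            = 2 * (C s * mat_adjoint (C s) * blk s (P l)) $$ (i, a)"
        proof -
          have "i < tdims B ! l" "s < t" "a < \<kappa> l s" using ai s by (auto simp: n_def)
          from G(2)[OF this] show ?thesis by (simp only: partial_gram_def C_def blk_def)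
        qed
        moreover have "blk s Z $$ (i, a) = Z $$ (i, (\<Sum>r<s. \<kappa> l r) + a)"
          using ai Z by (simp add: blk_def col_block_def)
        moreover have "Re (u * (2 * v)) = 2 * Re (u * v)" for u v by simp
        ultimately show "Re (cnj (Z $$ (i, (\<Sum>r<s. \<kappa> l r) + a)) * bd_gradient B t \<kappa> l P $$ (i, (\<Sum>r<s. \<kappa> l r) + a))
            = 2 * Re (cnj (blk s Z $$ (i, a)) * (C s * mat_adjoint (C s) * blk s (P l)) $$ (i, a))"
          by (simp only:)
      qed
    qed
    finally have inner: "mat_rinner (bd_gradient B t \<kappa> l P) Z
        = (\<Sum>s<t. 2 * mat_rinner (C s * mat_adjoint (C s) * blk s (P l)) (blk s Z))" .
    have "\<phi> (P l + Z) = (\<Sum>s<t. mode_quad (\<kappa> l s) (C s) (blk s (P l)) + mode_quad (\<kappa> l s) (C s) (blk s Z)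
         + 2 * mat_rinner (C s * mat_adjoint (C s) * blk s (P l)) (blk s Z))"
      using P' Z
      by (subst \<phi>, simp) (intro sum.cong refl, simp add: add mode_quad_add[OF blkc[OF P'] blkc[OF Z] dC])
    then show ?thesis
      unfolding inner \<phi>[OF P'] by (simp add: sum.distrib)
  qed
  have bound: "\<bar>\<phi> (P l + Z) - \<phi> (P l) - mat_rinner (bd_gradient B t \<kappa> l P) Z\<bar> \<le> K * (mat_fnorm Z)\<^sup>2"
    if Z: "Z \<in> carrier_mat n k" for Z
  proof -
    have b: "cmod (blk s Z $$ (i, a)) \<le> mat_fnorm Z" if "s < t" "i < dim_row (C s)" "a < \<kappa> l s" for s i a
      using that Z offset_less[of s t a "\<kappa> l"] cmod_le_mat_fnorm[OF Z, of i "(\<Sum>r<s. \<kappa> l r) + a"]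
      by (simp add: blk_def col_block_def dC k_def)
    have "(\<Sum>s<t. mode_quad (\<kappa> l s) (C s) (blk s Z)) \<le> K * (mat_fnorm Z)\<^sup>2"
      unfolding K_def sum_distrib_right[where A = "{..<t}"]
      by (intro sum_mono mode_quad_bounds(2)) (use b in auto)
    moreover have "0 \<le> (\<Sum>s<t. mode_quad (\<kappa> l s) (C s) (blk s Z))"
      by (simp add: mode_quad_def sum_nonneg)
    ultimately show ?thesis unfolding expand[OF Z] by simp
  qed
  have "\<exists>d>0. \<forall>Z \<in> carrier_mat n k. mat_fnorm Z < d \<longrightarrow>
        \<bar>\<phi> (P l + Z) - \<phi> (P l) - mat_rinner (bd_gradient B t \<kappa> l P) Z\<bar> \<le> e * mat_fnorm Z" if "e > 0" for e
  proof (intro exI[of _ "e / (K + 1)"] conjI ballI impI)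
    show "0 < e / (K + 1)" using that K0 by simp
    fix Z assume Z: "Z \<in> carrier_mat n k" and lt: "mat_fnorm Z < e / (K + 1)"
    have nn: "0 \<le> mat_fnorm Z" using Z by (rule mat_fnorm_nonneg)
    have "K * mat_fnorm Z \<le> (K + 1) * mat_fnorm Z" using nn by (simp add: mult_right_mono)
    also have "\<dots> \<le> e" using lt K0 by (simp add: field_simps)
    finally have "K * mat_fnorm Z * mat_fnorm Z \<le> e * mat_fnorm Z" using nn by (rule mult_right_mono)
    then show "\<bar>\<phi> (P l + Z) - \<phi> (P l) - mat_rinner (bd_gradient B t \<kappa> l P) Z\<bar> \<le> e * mat_fnorm Z"
      using bound[OF Z] by (simp add: power2_eq_square mult.assoc)
  qed
  then show ?thesis
    unfolding is_euclidean_gradient_def \<phi>_def[symmetric] n_def[symmetric] k_def[symmetric]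
    using Gc by blast
qed

end

theory Submission
  imports Defs
begin

text \<open>
  The objective is a convex function of \<open>P\<^sub>l\<close> alone, so at a global maximizer
  \<open>\<langle>G, W - P\<^sub>l\<rangle> \<le> 0\<close> for every \<open>W\<close> in the Stiefel manifold, where \<open>G\<close> is the partial gradient.
  Take \<open>W = (1 - c u u\<^sup>H) P\<^sub>l\<close> with \<open>c = 1 / (N/2 - \<i>y)\<close>, \<open>N = u\<^sup>H u\<close>; the first factor is unitary
  for every real \<open>y\<close>. With \<open>q = u\<^sup>H G P\<^sub>l\<^sup>H u\<close> the inequality becomes \<open>(N/2) Re q + y Im q \<ge> 0\<close>.
  As \<open>y\<close> is arbitrary, \<open>q\<close> is real and nonnegative, so \<open>G P\<^sub>l\<^sup>H\<close> is Hermitian positive semidefinite.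
  Multiplying \<open>G P\<^sub>l\<^sup>H = P\<^sub>l G\<^sup>H\<close> by \<open>P\<^sub>l\<close> on the right
  gives \<open>G = P\<^sub>l (G\<^sup>H P\<^sub>l)\<close>, and \<open>P\<^sub>l\<^sup>H G = P\<^sub>l\<^sup>H (G P\<^sub>l\<^sup>H) P\<^sub>l\<close> inherits positivity.
\<close>

section \<open>Adjoints, quadratic forms and unitary rank-one updates\<close>

lemma mat_adjoint_mult:
  fixes A C :: "complex mat"
  assumes "A \<in> carrier_mat n k" "C \<in> carrier_mat k p"
  shows "mat_adjoint (A * C) = mat_adjoint C * mat_adjoint A"
  using assms by (intro eq_matI) (auto simp: scalar_prod_def mult.commute)

lemma mat_adjoint_adjoint: "mat_adjoint (mat_adjoint A) = (A :: complex mat)"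
  by (intro eq_matI) auto

lemma mat_adjoint_carrier: "A \<in> carrier_mat n k \<Longrightarrow> mat_adjoint A \<in> carrier_mat k n"
  by (intro carrier_matI) auto

lemma quadratic_form_sum:
  fixes A :: "complex mat"
  assumes "A \<in> carrier_mat n n" "u \<in> carrier_vec n"
  shows "(A *\<^sub>v u) \<bullet>c u = (\<Sum>i<n. \<Sum>j<n. cnj (u $ i) * A $$ (i, j) * u $ j)"
proof -
  have "(A *\<^sub>v u) \<bullet>c u = (\<Sum>i<n. (\<Sum>j<n. A $$ (i, j) * u $ j) * cnj (u $ i))"
    using assms by (simp add: scalar_prod_def atLeast0LessThan)
  also have "\<dots> = (\<Sum>i<n. cnj (u $ i) * (\<Sum>j<n. A $$ (i, j) * u $ j))"
    by (simp only: mult.commute)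
  finally show ?thesis by (simp add: sum_distrib_left mult.assoc)
qed

text \<open>Polarization: the form at \<open>e_i + c e_j\<close> contains the off-diagonal terms
  \<open>c * A_ij + cnj c * A_ji\<close>, which suitable \<open>c\<close> isolate.\<close>

lemma hermitian_if_real_quadratic_form:
  fixes A :: "complex mat"
  assumes A: "A \<in> carrier_mat n n"
    and real: "\<And>u. u \<in> carrier_vec n \<Longrightarrow> Im ((A *\<^sub>v u) \<bullet>c u) = 0"
  shows "mat_adjoint A = A"
proof (rule eq_matI)
  fix i j assume "i < dim_row A" "j < dim_col A"
  then have ij: "i < n" "j < n" using A by auto
  have form: "Im (A $$ (i, i) + c * A $$ (i, j) + cnj c * A $$ (j, i) + cnj c * c * A $$ (j, j)) = 0" for c
  proof -
    \<comment> \<open>Adding two indicators gives \<open>e_i + c e_j\<close> also for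
      \<open>i = j\<close>, so the diagonal needs no separate case.\<close>
    define u where "u = vec n (\<lambda>a. (if a = i then 1 else 0) + (if a = j then c else 0))"
    have u: "u \<in> carrier_vec n" by (simp add: u_def)
    have row: "(\<Sum>b<n. x * A $$ (a, b) * u $ b) = x * (A $$ (a, i) + c * A $$ (a, j))" for a x
    proof -
      have "(\<Sum>b<n. x * A $$ (a, b) * u $ b)
          = (\<Sum>b<n. (if b = i then x * A $$ (a, b) else 0) + (if b = j then x * A $$ (a, b) * c else 0))"
        by (intro sum.cong) (auto simp: u_def algebra_simps)
      also have "\<dots> = x * (A $$ (a, i) + c * A $$ (a, j))"
        using ij by (simp add: sum.distrib algebra_simps)
      finally show ?thesis .
    qed
    have "(A *\<^sub>v u) \<bullet>c u = (\<Sum>a<n. cnj (u $ a) * (A $$ (a, i) + c * A $$ (a, j)))"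
      unfolding quadratic_form_sum[OF A u] row ..
    also have "\<dots> = (\<Sum>a<n. (if a = i then A $$ (a, i) + c * A $$ (a, j) else 0)
        + (if a = j then cnj c * (A $$ (a, i) + c * A $$ (a, j)) else 0))"
      by (intro sum.cong) (auto simp: u_def algebra_simps)
    also have "\<dots> = A $$ (i, i) + c * A $$ (i, j) + cnj c * A $$ (j, i) + cnj c * c * A $$ (j, j)"
      using ij by (simp add: sum.distrib algebra_simps)
    finally show ?thesis using real[OF u] by simp
  qed
  \<comment> \<open>Subtracting the identities for \<open>c\<close> and \<open>-c\<close> removes
    the diagonal terms; \<open>c = 1\<close> yields the imaginary parts and \<open>c = \<i>\<close>
    the real parts.\<close>
  have "Im (A $$ (i, j)) = - Im (A $$ (j, i))" "Re (A $$ (i, j)) = Re (A $$ (j, i))"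
    using form[of 0] form[of 1] form[of "-1"] form[of \<i>] form[of "-\<i>"] by simp_all
  then show "mat_adjoint A $$ (i, j) = A $$ (i, j)"
    using A ij by (simp add: complex_eq_iff)
qed (use A in auto)

text \<open>The condition on \<open>c\<close> says that \<open>1 - c u u\<^sup>H\<close> is unitary.\<close>

lemma stiefel_rank_one_update:
  assumes P: "P \<in> stiefel k n"
    and c: "c + cnj c = c * cnj c * (\<Sum>i<n. u i * cnj (u i))"
  shows "mat n k (\<lambda>(i, a). P $$ (i, a) - c * u i * (\<Sum>j<n. cnj (u j) * P $$ (j, a))) \<in> stiefel k n"
    (is "?W \<in> _")
proof -
  define x where "x a = (\<Sum>j<n. cnj (u j) * P $$ (j, a))" for a
  have Pc: "P \<in> carrier_mat n k" and PP: "mat_adjoint P * P = 1\<^sub>m k"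
    using P by (auto simp: stiefel_def)
  have entry: "(mat_adjoint X * X) $$ (a, b) = (\<Sum>i<n. cnj (X $$ (i, a)) * X $$ (i, b))"
    if "X \<in> carrier_mat n k" "a < k" "b < k" for X :: "complex mat" and a b
    using that by (simp add: scalar_prod_def atLeast0LessThan)
  have "(mat_adjoint ?W * ?W) $$ (a, b) = 1\<^sub>m k $$ (a, b)" if ab: "a < k" "b < k" for a b
  proof -
    have "(mat_adjoint ?W * ?W) $$ (a, b)
        = (\<Sum>i<n. cnj (P $$ (i, a) - c * u i * x a) * (P $$ (i, b) - c * u i * x b))"
      using ab by (subst entry) (auto simp: x_def intro!: sum.cong)
    also have "\<dots> = (\<Sum>i<n. cnj (P $$ (i, a)) * P $$ (i, b))
        - c * x b * (\<Sum>i<n. u i * cnj (P $$ (i, a)))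
        - cnj c * cnj (x a) * (\<Sum>i<n. cnj (u i) * P $$ (i, b))
        + c * cnj c * cnj (x a) * x b * (\<Sum>i<n. u i * cnj (u i))"
      unfolding sum_distrib_left sum_subtractf[symmetric] sum.distrib[symmetric]
      by (intro sum.cong) (auto simp: algebra_simps)
    also have "(\<Sum>i<n. u i * cnj (P $$ (i, a))) = cnj (x a)"
      by (simp add: x_def)
    also have "(\<Sum>i<n. cnj (P $$ (i, a)) * P $$ (i, b)) = 1\<^sub>m k $$ (a, b)"
      using entry[OF Pc ab] PP by simp
    also have "(\<Sum>i<n. cnj (u i) * P $$ (i, b)) = x b" by (simp add: x_def)
    \<comment> \<open>The deviation from the identity is \<open>cnj (x a) * x b\<close> times the
      difference of the two sides of the hypothesis on \<open>c\<close>.\<close>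
    also have "1\<^sub>m k $$ (a, b) - c * x b * cnj (x a) - cnj c * cnj (x a) * x b
        + c * cnj c * cnj (x a) * x b * (\<Sum>i<n. u i * cnj (u i))
      = 1\<^sub>m k $$ (a, b) + cnj (x a) * x b * (c * cnj c * (\<Sum>i<n. u i * cnj (u i)) - (c + cnj c))"
      by (simp add: algebra_simps)
    finally show ?thesis unfolding c[symmetric] by simp
  qed
  then show ?thesis by (auto simp: stiefel_def)
qed

section \<open>Maximizers of a linear functional over the Stiefel manifold\<close>

lemma real_nonneg_if_affine_nonneg:
  fixes a b N :: real
  assumes "N > 0" and nonneg: "\<And>y. N * a + y * b \<ge> 0"
  shows "a \<ge> 0 \<and> b = 0"
proof -
  have "b = 0"
  proof (rule ccontr)
    assume "b \<noteq> 0"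
    \<comment> \<open>At this \<open>y\<close> the affine function takes the value -1.\<close>
    then show False using nonneg[of "- (N * a + 1) / b"] by simp
  qed
  then show ?thesis using assms nonneg[of 0] by (simp add: zero_le_mult_iff)
qed

lemma stiefel_linear_maximizer_form_nonneg:
  assumes P: "P \<in> stiefel k n" and G: "G \<in> carrier_mat n k" and u: "u \<in> carrier_vec n"
    and max: "\<And>W. W \<in> stiefel k n \<Longrightarrow> mat_rinner G (W - P) \<le> 0"
  shows "0 \<le> Re ((G * mat_adjoint P *\<^sub>v u) \<bullet>c u) \<and> Im ((G * mat_adjoint P *\<^sub>v u) \<bullet>c u) = 0"
\<comment> \<open>For \<open>u = 0\<close> the form vanishes. Otherwise \<open>N > 0\<close>, which
  makes \<open>d\<close> below invertible for every \<open>y\<close>.\<close>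
proof (cases "u = 0\<^sub>v n")
  case True
  have "G * mat_adjoint P \<in> carrier_mat n n"
    using P G by (auto simp: stiefel_def intro: mat_adjoint_carrier)
  then show ?thesis using True u by (simp add: quadratic_form_sum)
next
  case False
  have Pc: "P \<in> carrier_mat n k" using P by (simp add: stiefel_def)
  define q where "q = (G * mat_adjoint P *\<^sub>v u) \<bullet>c u"
  define N where "N = (\<Sum>i<n. (cmod (u $ i))\<^sup>2)"
  define x where "x a = (\<Sum>j<n. cnj (u $ j) * P $$ (j, a))" for a
  have N: "(\<Sum>i<n. u $ i * cnj (u $ i)) = of_real N"
    by (simp add: N_def complex_norm_square del: of_real_power)
  obtain i where "i < n" "u $ i \<noteq> 0" using False eq_vecI[of "0\<^sub>v n" u] u by auto
  then have "0 < N" unfolding N_def by (intro sum_pos2[of _ i]) auto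
  have Q: "G * mat_adjoint P \<in> carrier_mat n n"
    using G Pc by (auto intro: mat_adjoint_carrier)
  \<comment> \<open>Here \<open>x\<close> is the row \<open>u^H P\<close>; written through it,
    \<open>q\<close> can be recognized in the inner product of \<open>G\<close> with
    \<open>W - P\<close>.\<close>
  have q: "q = (\<Sum>a<k. cnj (x a) * (\<Sum>i<n. cnj (u $ i) * G $$ (i, a)))"
  proof -
    have "q = (\<Sum>i<n. \<Sum>j<n. \<Sum>a<k. cnj (u $ i) * G $$ (i, a) * (cnj (P $$ (j, a)) * u $ j))"
      unfolding q_def quadratic_form_sum[OF Q u] using G Pc
      by (auto simp: scalar_prod_def atLeast0LessThan sum_distrib_left sum_distrib_right mult.assoc
          intro!: sum.cong)
    also have "\<dots> = (\<Sum>i<n. \<Sum>a<k. \<Sum>j<n. cnj (u $ i) * G $$ (i, a) * (cnj (P $$ (j, a)) * u $ j))"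
      by (intro sum.cong refl sum.swap)
    also have "\<dots> = (\<Sum>a<k. \<Sum>i<n. \<Sum>j<n. cnj (u $ i) * G $$ (i, a) * (cnj (P $$ (j, a)) * u $ j))"
      by (rule sum.swap)
    also have "\<dots> = (\<Sum>a<k. \<Sum>i<n. cnj (u $ i) * G $$ (i, a) * cnj (x a))"
      unfolding sum_distrib_left[symmetric] by (simp add: x_def mult.commute)
    finally show ?thesis by (simp add: sum_distrib_left mult.commute)
  qed
  have "0 \<le> N / 2 * Re q + y * Im q" for y
  proof -
    \<comment> \<open>With \<open>c = 1 / d\<close>, unitarity reads \<open>d + cnj d = N\<close>:
      this fixes the real part of \<open>d\<close> and leaves the imaginary part free.\<close>
    define d where "d = Complex (N / 2) (- y)"
    define c where "c = inverse d"
    have d0: "d \<noteq> 0" using \<open>0 < N\<close> by (simp add: d_def complex_eq_iff)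
    have "c + cnj c = c * cnj c * (d + cnj d)"
      using d0 by (simp add: c_def field_simps)
    also have "d + cnj d = of_real N" by (simp add: d_def complex_eq_iff)
    finally have c: "c + cnj c = c * cnj c * (\<Sum>i<n. u $ i * cnj (u $ i))" unfolding N .
    define W where "W = mat n k (\<lambda>(i, a). P $$ (i, a) - c * u $ i * x a)"
    have W: "W \<in> stiefel k n"
      unfolding W_def x_def by (rule stiefel_rank_one_update[OF P c])
    \<comment> \<open>\<open>W - P\<close> is the rank-one matrix \<open>- c u x\<close>.\<close>
    have "mat_rinner G (W - P) = (\<Sum>a<k. \<Sum>i<n. - Re (cnj c * (cnj (x a) * (cnj (u $ i) * G $$ (i, a)))))"
      using G Pc by (subst mat_rinner_sum[where n = n and k = k])
        (auto simp: W_def minus_carrier_mat ac_simps simp del: complex_cnj_cnj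
          intro!: sum.cong arg_cong[where f = Re])
    also have "\<dots> = - Re (cnj c * q)"
      unfolding q by (simp only: sum_negf Re_sum sum_distrib_left)
    finally have "0 \<le> Re (cnj c * q)" using max[OF W] by simp
    \<comment> \<open>A positive factor is split off, since only the sign of the real part matters;
      \<open>Re (d * q)\<close> is the desired affine function of \<open>y\<close>.\<close>
    moreover have "cnj c * q = of_real (1 / (cmod d)\<^sup>2) * (d * q)"
      using d0 unfolding c_def by (simp add: complex_norm_square field_simps del: of_real_power)
    ultimately have "0 \<le> 1 / (cmod d)\<^sup>2 * Re (d * q)" by (simp del: times_complex.sel)
    then have "0 \<le> Re (d * q)" using d0 by (simp add: zero_le_divide_iff del: times_complex.sel)
    then show ?thesis by (simp add: d_def)
  qed
  then have "0 \<le> Re q \<and> Im q = 0"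
    using \<open>0 < N\<close> by (intro real_nonneg_if_affine_nonneg[of "N / 2"]) auto
  then show ?thesis by (simp add: q_def)
qed

lemma stiefel_linear_maximizer:
  assumes P: "P \<in> stiefel k n" and G: "G \<in> carrier_mat n k"
    and max: "\<And>W. W \<in> stiefel k n \<Longrightarrow> mat_rinner G (W - P) \<le> 0"
  shows "G = P * (mat_adjoint P * G)" and "hermitian_psd (mat_adjoint P * G)"
proof -
  define Q where "Q = G * mat_adjoint P"
  have Pc: "P \<in> carrier_mat n k" and PP: "mat_adjoint P * P = 1\<^sub>m k"
    using P by (auto simp: stiefel_def)
  note P'c = mat_adjoint_carrier[OF Pc] and G'c = mat_adjoint_carrier[OF G]
  have Qc: "Q \<in> carrier_mat n n" unfolding Q_def using G P'c by (rule mult_carrier_mat)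
  note form = stiefel_linear_maximizer_form_nonneg[OF P G _ max, folded Q_def]
  have "mat_adjoint Q = Q"
    using form by (intro hermitian_if_real_quadratic_form[OF Qc]) auto
  then have sym: "P * mat_adjoint G = Q"
    unfolding Q_def mat_adjoint_mult[OF G P'c] mat_adjoint_adjoint .
  have QP: "Q * P = G"
    unfolding Q_def assoc_mult_mat[OF G P'c Pc] PP using G by simp
  have GP: "G = P * (mat_adjoint G * P)"
    unfolding assoc_mult_mat[OF Pc G'c Pc, symmetric] sym QP ..
  \<comment> \<open>Cancelling \<open>P\<close> by orthonormality of its columns identifies the
    multiplier with its own adjoint.\<close>
  have "mat_adjoint P * G = mat_adjoint P * (P * (mat_adjoint G * P))"
    using GP by simp
  also have "\<dots> = (mat_adjoint P * P) * (mat_adjoint G * P)"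
    by (rule assoc_mult_mat[symmetric, OF P'c Pc mult_carrier_mat[OF G'c Pc]])
  also have "\<dots> = mat_adjoint G * P"
    unfolding PP by (rule left_mult_one_mat[OF mult_carrier_mat[OF G'c Pc]])
  finally have \<Lambda>: "mat_adjoint P * G = mat_adjoint G * P" .
  show "G = P * (mat_adjoint P * G)" unfolding \<Lambda> by (rule GP)
  have "mat_adjoint (mat_adjoint P * G) = mat_adjoint G * P"
    unfolding mat_adjoint_mult[OF P'c G] mat_adjoint_adjoint ..
  then have herm: "mat_adjoint (mat_adjoint P * G) = mat_adjoint P * G"
    unfolding \<Lambda>[symmetric] .
  have "0 \<le> Re ((mat_adjoint P * G *\<^sub>v v) \<bullet>c v)" if v: "v \<in> carrier_vec k" for v
  proof -
    have Pv: "P *\<^sub>v v \<in> carrier_vec n" using Pc v by (rule mult_mat_vec_carrier)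
    have Gv: "G *\<^sub>v v \<in> carrier_vec n" using G v by (rule mult_mat_vec_carrier)
    have adj: "(mat_adjoint P *\<^sub>v w) \<bullet>c v = w \<bullet>c (P *\<^sub>v v)" if w: "w \<in> carrier_vec n" for w
    proof -
      have "(mat_adjoint P *\<^sub>v w) \<bullet>c v = (\<Sum>a<k. \<Sum>i<n. cnj (P $$ (i, a)) * w $ i * cnj (v $ a))"
        using Pc v w by (auto simp: scalar_prod_def atLeast0LessThan sum_distrib_right intro!: sum.cong)
      also have "\<dots> = (\<Sum>i<n. \<Sum>a<k. cnj (P $$ (i, a)) * w $ i * cnj (v $ a))"
        by (rule sum.swap)
      also have "\<dots> = w \<bullet>c (P *\<^sub>v v)"
        using Pc v w
        by (auto simp: scalar_prod_def atLeast0LessThan sum_distrib_left intro!: sum.cong)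
      finally show ?thesis .
    qed
    \<comment> \<open>Because \<open>Q * P = G\<close>, the form of the multiplier at
      \<open>v\<close> is the form of \<open>Q\<close> at \<open>P v\<close>.\<close>
    have "(mat_adjoint P * G *\<^sub>v v) \<bullet>c v = (mat_adjoint P *\<^sub>v (G *\<^sub>v v)) \<bullet>c v"
      by (simp only: assoc_mult_mat_vec[OF P'c G v])
    also have "\<dots> = (G *\<^sub>v v) \<bullet>c (P *\<^sub>v v)" by (rule adj[OF Gv])
    also have "G *\<^sub>v v = Q *\<^sub>v (P *\<^sub>v v)"
      unfolding assoc_mult_mat_vec[OF Qc Pc v, symmetric] QP ..
    finally show ?thesis using form[OF Pv] by simp
  qed
  then show "hermitian_psd (mat_adjoint P * G)"
    using herm Pc G by (auto simp: hermitian_psd_def)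
qed

section \<open>Convexity of the objective in a single factor\<close>

text \<open>The convexity gap is exactly \<open>h * (1 - h) * (cmod z)^2\<close>.\<close>

lemma cmod_sq_convex:
  fixes p z :: complex and h :: real
  assumes "0 \<le> h" "h \<le> 1"
  shows "(cmod (p + of_real h * z))\<^sup>2 \<le> (1 - h) * (cmod p)\<^sup>2 + h * (cmod (p + z))\<^sup>2"
proof -
  have "(1 - h) * (cmod p)\<^sup>2 + h * (cmod (p + z))\<^sup>2 - (cmod (p + of_real h * z))\<^sup>2
      = h * (1 - h) * (cmod z)\<^sup>2"
    unfolding cmod_power2 by (simp add: power2_eq_square algebra_simps)
  moreover have "0 \<le> h * (1 - h) * (cmod z)\<^sup>2" using assms by simp
  ultimately show ?thesis by linarith
qed

text \<open>Each summand is the squared modulus of a quantity that is conjugate-linear in the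
  matrix, hence affine along a real segment, so \<open>cmod_sq_convex\<close> applies
  termwise.\<close>

lemma mode_quad_convex:
  assumes X: "X \<in> carrier_mat n k" and Z: "Z \<in> carrier_mat n k" and C: "dim_row C = n"
    and h: "0 \<le> h" "h \<le> 1"
  shows "mode_quad k C (X + of_real h \<cdot>\<^sub>m Z) \<le> (1 - h) * mode_quad k C X + h * mode_quad k C (X + Z)"
proof -
  define x where "x Y a c = (\<Sum>j<n. cnj (Y $$ (j, a)) * C $$ (j, c))" for Y :: "complex mat" and a c
  have add: "x (X + of_real r \<cdot>\<^sub>m Z) a c = x X a c + of_real r * x Z a c" if "a < k" for a c r
    using that X Z by (simp add: x_def sum.distrib distrib_right sum_distrib_left mult.assoc)
  \<comment> \<open>This lets \<open>add\<close> with \<open>r = 1\<close> cover the endpoint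
    \<open>X + Z\<close>.\<close>
  have one: "of_real 1 \<cdot>\<^sub>m Z = Z" by (intro eq_matI) auto
  have "(cmod (x (X + of_real h \<cdot>\<^sub>m Z) a c))\<^sup>2 \<le> (1 - h) * (cmod (x X a c))\<^sup>2 + h * (cmod (x (X + Z) a c))\<^sup>2"
    if "a < k" for a c
    using cmod_sq_convex[OF h, of "x X a c" "x Z a c"] add[OF that, of h] add[OF that, of 1]
    by (simp add: one[simplified])
  then show ?thesis
    unfolding mode_quad_def C x_def[symmetric] sum_distrib_left sum.distrib[symmetric]
    by (intro sum_mono) auto
qed

text \<open>The unfoldings do not involve the factor of mode \<open>l\<close>, and taking column
  blocks is linear, so the claim reduces to \<open>mode_quad_convex\<close> for each block.\<close>

lemma bd_objective_convex:
  assumes l: "l < length (tdims B)" and X: "X \<in> carrier_mat (tdims B ! l) (\<Sum>s<t. \<kappa> l s)"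
    and Z: "Z \<in> carrier_mat (tdims B ! l) (\<Sum>s<t. \<kappa> l s)" and h: "0 \<le> h" "h \<le> 1"
  shows "bd_objective B t \<kappa> (P(l := X + of_real h \<cdot>\<^sub>m Z))
       \<le> (1 - h) * bd_objective B t \<kappa> (P(l := X)) + h * bd_objective B t \<kappa> (P(l := X + Z))"
proof -
  let ?b = "col_block (\<kappa> l)"
  let ?C = "partial_unfolding B \<kappa> P l"
  have dC: "dim_row (?C s) = tdims B ! l" for s
    by (simp add: partial_unfolding_def unfolding_mat_def Let_def nth_tdims_mode_mults)
  have blk: "?b s Y \<in> carrier_mat (tdims B ! l) (\<kappa> l s)"
    if "Y \<in> carrier_mat (tdims B ! l) (\<Sum>s<t. \<kappa> l s)" for s Y
    using that by (auto simp: col_block_def)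
  have "?b s (X + of_real h \<cdot>\<^sub>m Z) = ?b s X + of_real h \<cdot>\<^sub>m ?b s Z" "?b s (X + Z) = ?b s X + ?b s Z"
    if "s < t" for s
    using that X Z offset_less[of s t _ "\<kappa> l"] by (auto simp: col_block_def intro!: eq_matI)
  then have "mode_quad (\<kappa> l s) (?C s) (?b s (X + of_real h \<cdot>\<^sub>m Z))
      \<le> (1 - h) * mode_quad (\<kappa> l s) (?C s) (?b s X) + h * mode_quad (\<kappa> l s) (?C s) (?b s (X + Z))"
    if "s < t" for s
    using that mode_quad_convex[OF blk[OF X] blk[OF Z] dC h] by simp
  then have "(\<Sum>s<t. mode_quad (\<kappa> l s) (?C s) (?b s (X + of_real h \<cdot>\<^sub>m Z)))
      \<le> (\<Sum>s<t. (1 - h) * mode_quad (\<kappa> l s) (?C s) (?b s X) + h * mode_quad (\<kappa> l s) (?C s) (?b s (X + Z)))"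
    by (intro sum_mono) simp
  moreover have "dim_row (X + of_real h \<cdot>\<^sub>m Z) = tdims B ! l" "dim_row X = tdims B ! l"
    "dim_row (X + Z) = tdims B ! l"
    using X Z by auto
  ultimately show ?thesis
    by (simp only: bd_objective_update[OF l] sum.distrib sum_distrib_left)
qed

section \<open>First-order condition at a global maximizer\<close>

text \<open>A positive inner product would dominate the remainder, which is o(h), and force an
  increase of \<open>\<phi>\<close> for small \<open>h\<close>.\<close>

lemma euclidean_gradient_nonincreasing_direction:
  assumes grad: "is_euclidean_gradient n k \<phi> X G" and Z: "Z \<in> carrier_mat n k"
    and le: "\<And>h. 0 < h \<Longrightarrow> h \<le> 1 \<Longrightarrow> \<phi> (X + of_real h \<cdot>\<^sub>m Z) \<le> \<phi> X"
  shows "mat_rinner G Z \<le> 0"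
proof (rule ccontr)
  assume "\<not> mat_rinner G Z \<le> 0"
  then have pos: "0 < mat_rinner G Z" by simp
  have G: "G \<in> carrier_mat n k" using grad by (simp add: is_euclidean_gradient_def)
  have nn: "0 \<le> mat_fnorm Z" using Z by (rule mat_fnorm_nonneg)
  \<comment> \<open>Chosen so that \<open>e * mat_fnorm Z\<close> stays below half the inner
    product; the added 1 avoids division by zero.\<close>
  define e where "e = mat_rinner G Z / (2 * (mat_fnorm Z + 1))"
  have "0 < e" using pos nn by (simp add: e_def)
  then obtain d where d: "0 < d" and
    approx: "\<And>Y. Y \<in> carrier_mat n k \<Longrightarrow> mat_fnorm Y < d \<Longrightarrow>
        \<bar>\<phi> (X + Y) - \<phi> X - mat_rinner G Y\<bar> \<le> e * mat_fnorm Y"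
    using grad unfolding is_euclidean_gradient_def by blast
  \<comment> \<open>The cap 1 makes \<open>le\<close> applicable; the other bound keeps the norm of
    the scaled direction below \<open>d\<close>.\<close>
  define h where "h = min 1 (d / (2 * (mat_fnorm Z + 1)))"
  have h: "0 < h" "h \<le> 1" using d nn by (auto simp: h_def)
  have hZ: "of_real h \<cdot>\<^sub>m Z \<in> carrier_mat n k" using Z by simp
  have "(mat_fnorm (of_real h \<cdot>\<^sub>m Z))\<^sup>2 = (h * mat_fnorm Z)\<^sup>2"
    using Z by (simp add: mat_fnorm_sq[OF hZ] mat_fnorm_sq[OF Z] power_mult_distrib norm_mult sum_distrib_left)
  then have norm: "mat_fnorm (of_real h \<cdot>\<^sub>m Z) = h * mat_fnorm Z"
    using h nn mat_fnorm_nonneg[OF hZ] by (simp add: power2_eq_iff_nonneg)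
  have inner: "mat_rinner G (of_real h \<cdot>\<^sub>m Z) = h * mat_rinner G Z"
    using Z unfolding mat_rinner_sum[OF G hZ] mat_rinner_sum[OF G Z]
    by (simp add: sum_distrib_left algebra_simps)
  have "h * mat_fnorm Z \<le> d / (2 * (mat_fnorm Z + 1)) * mat_fnorm Z"
    using nn by (intro mult_right_mono) (auto simp: h_def)
  also have "\<dots> < d" using d nn by (simp add: field_simps add_nonneg_pos)
  finally have "\<bar>\<phi> (X + of_real h \<cdot>\<^sub>m Z) - \<phi> X - h * mat_rinner G Z\<bar> \<le> e * (h * mat_fnorm Z)"
    using approx[OF hZ] by (simp add: norm inner)
  then have "h * mat_rinner G Z \<le> h * (e * mat_fnorm Z)"
    using le[OF h] by (simp add: algebra_simps abs_le_iff)
  then have "mat_rinner G Z \<le> e * mat_fnorm Z" using h by simp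
  also have "\<dots> < mat_rinner G Z" using pos nn by (simp add: e_def field_simps add_nonneg_pos)
  finally show False by simp
qed

text \<open>The segment from \<open>P l\<close> to \<open>W\<close> generally leaves the Stiefel
  manifold, so maximality is available only at its endpoints; convexity carries the bound to the
  points between them.\<close>

lemma bd_global_maximizer_first_order:
  assumes max: "bd_global_maximizer B t \<kappa> P" and l: "l < length (tdims B)"
    and W: "W \<in> stiefel (\<Sum>s<t. \<kappa> l s) (tdims B ! l)"
  shows "mat_rinner (bd_gradient B t \<kappa> l P) (W - P l) \<le> 0"
proof -
  let ?n = "tdims B ! l" and ?k = "\<Sum>s<t. \<kappa> l s"
  have tup: "stiefel_tuple B t \<kappa> P"
    and best: "\<And>Q. stiefel_tuple B t \<kappa> Q \<Longrightarrow> bd_objective B t \<kappa> Q \<le> bd_objective B t \<kappa> P"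
    using max by (auto simp: bd_global_maximizer_def)
  have Pc: "P l \<in> carrier_mat ?n ?k" and Wc: "W \<in> carrier_mat ?n ?k"
    using tup l W by (auto simp: stiefel_tuple_def stiefel_def)
  have Z: "W - P l \<in> carrier_mat ?n ?k" using Pc by (rule minus_carrier_mat)
  have PZ: "P l + (W - P l) = W" using Pc Wc by (intro eq_matI) auto
  have "stiefel_tuple B t \<kappa> (P(l := W))" using tup W by (simp add: stiefel_tuple_def)
  note leW = best[OF this]
  show ?thesis
  proof (rule euclidean_gradient_nonincreasing_direction[
      OF bd_gradient_is_euclidean_gradient[where P = P and t = t and \<kappa> = \<kappa>, OF l Pc] Z])
    fix h :: real assume h: "0 < h" "h \<le> 1"
    have "bd_objective B t \<kappa> (P(l := P l + of_real h \<cdot>\<^sub>m (W - P l)))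
        \<le> (1 - h) * bd_objective B t \<kappa> P + h * bd_objective B t \<kappa> (P(l := W))"
      using bd_objective_convex[where P = P and h = h and t = t and \<kappa> = \<kappa>, OF l Pc Z] h by (simp add: PZ)
    also have "\<dots> \<le> (1 - h) * bd_objective B t \<kappa> P + h * bd_objective B t \<kappa> P"
      using leW h by (intro add_left_mono mult_left_mono) auto
    finally show "bd_objective B t \<kappa> (P(l := P l + of_real h \<cdot>\<^sub>m (W - P l))) \<le> bd_objective B t \<kappa> (P(l := P l))"
      by (simp add: algebra_simps)
  qed
qed

section \<open>Positive semidefinite multipliers and the KKT condition for all modes\<close>

theorem theorem3p2:
  fixes B :: tensor and m t :: nat and n :: "nat \<Rightarrow> nat"
    and k :: "nat \<Rightarrow> nat" and \<kappa> :: "nat \<Rightarrow> nat \<Rightarrow> nat"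
    and P :: "nat \<Rightarrow> complex mat"
  assumes "m \<ge> 2" and "t \<ge> 1"
    and "tdims B = map n [0..<m]"
    and "\<And>l s. l < m \<Longrightarrow> s < t \<Longrightarrow> \<kappa> l s \<ge> 1"
    and "\<And>l. l < m \<Longrightarrow> k l = (\<Sum>s<t. \<kappa> l s)"
    and "\<And>l. l < m \<Longrightarrow> k l \<le> n l"
    and "bd_global_maximizer B t \<kappa> P"
  shows "(\<forall>l<m. \<exists>\<Lambda> \<in> carrier_mat (k l) (k l).
            \<Lambda> = mat_adjoint (P l) * bd_gradient B t \<kappa> l P \<and>
            bd_gradient B t \<kappa> l P = P l * \<Lambda> \<and>
            hermitian_psd \<Lambda>)
         \<and> bd_KKT B t \<kappa> P"
proof -
  have "bd_gradient B t \<kappa> l P \<in> carrier_mat (n l) (k l)" "P l \<in> stiefel (k l) (n l)"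
    "bd_gradient B t \<kappa> l P = P l * (mat_adjoint (P l) * bd_gradient B t \<kappa> l P)"
    "hermitian_psd (mat_adjoint (P l) * bd_gradient B t \<kappa> l P)" if l: "l < m" for l
  proof -
    have len: "l < length (tdims B)" and nl: "tdims B ! l = n l" using assms(3) l by auto
    note kl = assms(5)[OF l]
    show P: "P l \<in> stiefel (k l) (n l)"
      using assms(7) len by (auto simp: bd_global_maximizer_def stiefel_tuple_def nl kl)
    then show G: "bd_gradient B t \<kappa> l P \<in> carrier_mat (n l) (k l)"
      using bd_gradient_carrier_entry(1)[where P = P and t = t and \<kappa> = \<kappa>, OF len] by (simp add: nl kl stiefel_def)
    note first_order = bd_global_maximizer_first_order[OF assms(7) len, unfolded nl, folded kl]
    show "bd_gradient B t \<kappa> l P = P l * (mat_adjoint (P l) * bd_gradient B t \<kappa> l P)"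
      "hermitian_psd (mat_adjoint (P l) * bd_gradient B t \<kappa> l P)"
      using stiefel_linear_maximizer[OF P G first_order] by auto
  qed
  note main = this
  have carrier: "mat_adjoint (P l) * bd_gradient B t \<kappa> l P \<in> carrier_mat (k l) (k l)" if "l < m" for l
    using main(1,2)[OF that] by (auto simp: stiefel_def intro!: mult_carrier_mat mat_adjoint_carrier)
  have "bd_KKT B t \<kappa> P"
    unfolding bd_KKT_def
  proof (intro conjI allI impI)
    show "stiefel_tuple B t \<kappa> P" using assms(7) by (simp add: bd_global_maximizer_def)
    fix l assume "l < length (tdims B)"
    then have l: "l < m" using assms(3) by simp
    \<comment> \<open>The witness is the multiplier from \<open>main\<close>; its semidefiniteness
      includes Hermitian symmetry.\<close>
    show "\<exists>\<Lambda> \<in> carrier_mat (\<Sum>s<t. \<kappa> l s) (\<Sum>s<t. \<kappa> l s).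
        mat_adjoint \<Lambda> = \<Lambda> \<and> bd_gradient B t \<kappa> l P = P l * \<Lambda>"
      using main(3,4)[OF l] carrier[OF l] unfolding assms(5)[OF l] hermitian_psd_def by blast
  qed
  then show ?thesis using main carrier by blast
qed

end
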